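(* Let $H$ be a finite Heyting algebra. The Kleisli category of the comonad $\perp$ on $Heymod_H$ (the squaring comonad $M\mapsto M^2$) is given by $Heymod_H^2$; that is, under the identification of morphisms $M^2\to N$ in $Heymod_H$ with pairs $(f,g)$ of morphisms $M\to N$ in $Heymod_H$ (the pair $(f,g)$ corresponding to $(m,n)\mapsto f(m)\vee g(n)$), the Kleisli category of $\perp$ coincides with $Heymod_H^2$.
   Context: Lattices have all finite meets and joins (hence a least element $0$ and a greatest element $1$). A join semilattice is a poset in which every finite subset, including the empty one, has a join; its least element is $0$. For a distributive lattice $L$, a distributive module over $L$ is a join semilattice $M$ with an action $L\times M\to M$, $(x,m)\mapsto x\wedge m$, order preserving in both variables, such that $1\wedge m=m$, $0\wedge m=0$, $(x\wedge y)\wedge m=x\wedge(y\wedge m)$, $(x\vee y)\wedge m=(x\wedge m)\vee(y\wedge m)$, $x\wedge(m\vee n)=(x\wedge m)\vee(x\wedge n)$. Morphisms are maps preserving finite joins (including $0$) and satisfying $g(x\wedge m)=x\wedge g(m)$. A Heyting algebra $H$ is a lattice such that for all $y,z\in H$ there is $(y\to z)_H\in H$ with $x\wedge y\le z\Leftrightarrow x\le (y\to z)_H$ for all $x\in H$. A Heyting module over $H$ is a distributive module $M$ over $H$ such that for all $m,n\in M$ there is $(m\to n)_M\in H$ with $x\wedge m\le n\Leftrightarrow x\le(m\to n)_M$ for all $x\in H$; morphisms are morphisms of distributive modules. $Heymod_H$ is the resulting category; morphisms $f,g:M\to N$ have a sum $f+g$ given by $(f+g)(m)=f(m)\vee g(m)$.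 Products $M^2=M\times M$ are computed componentwise and are also coproducts. $Heymod_H^2$ is the category with the same objects as $Heymod_H$, in which a morphism $M\to N$ is a pair $(f,g)$ of morphisms $M\to N$ in $Heymod_H$, with composition $(f',g')\circ(f,g)=(f'\circ f+g'\circ g,\ f'\circ g+g'\circ f)$. The comonad $\perp$ on $Heymod_H$ is the endofunctor with $\perp M=M^2$ and $\perp f=(f,f):M^2\to N^2$ (acting componentwise), with counit $\epsilon(M):M^2\to M$, $(m,n)\mapsto m$, and comultiplication $\delta(M):M^2\to (M^2)^2$, $(m,n)\mapsto((m,n),(n,m))$. The Kleisli category of a comonad $(\perp,\delta,\epsilon)$ on $\mathcal C$ has the objects of $\mathcal C$, morphism sets $Kl_{\perp}(C_1,C_2)=\mathcal C(\perp C_1,C_2)$, and the composite of $f\in\mathcal C(\perp C_1,C_2)$ and $g\in\mathcal C(\perp C_2,C_3)$ is $g\circ(\perp f)\circ\delta(C_1)$. *)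

theory Defs
  imports "HOL-Algebra.Lattice" "HOL-Library.FuncSet"
begin

section \<open>Categories, comonads and Kleisli categories\<close>

text \<open>
  Composition carries its three objects: \<open>Cmp C A B D g f\<close> is the composite of
  \<open>f : A \<rightarrow> B\<close> and \<open>g : B \<rightarrow> D\<close>. Likewise the arrow map of a functor carries the domain
  and the codomain of its argument. Hom-sets need not be disjoint.
\<close>

record ('o, 'm) cat =
  Obj :: "'o set"
  Hom :: "'o \<Rightarrow> 'o \<Rightarrow> 'm set"
  Idn :: "'o \<Rightarrow> 'm"
  Cmp :: "'o \<Rightarrow> 'o \<Rightarrow> 'o \<Rightarrow> 'm \<Rightarrow> 'm \<Rightarrow> 'm"

locale category =
  fixes C :: "('o, 'm) cat"
  assumes Idn_in_Hom: "A \<in> Obj C \<Longrightarrow> Idn C A \<in> Hom C A A"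
    and Cmp_in_Hom:
      "\<lbrakk>A \<in> Obj C; B \<in> Obj C; D \<in> Obj C; f \<in> Hom C A B; g \<in> Hom C B D\<rbrakk>
        \<Longrightarrow> Cmp C A B D g f \<in> Hom C A D"
    and Cmp_Idn_left:
      "\<lbrakk>A \<in> Obj C; B \<in> Obj C; f \<in> Hom C A B\<rbrakk> \<Longrightarrow> Cmp C A B B (Idn C B) f = f"
    and Cmp_Idn_right:
      "\<lbrakk>A \<in> Obj C; B \<in> Obj C; f \<in> Hom C A B\<rbrakk> \<Longrightarrow> Cmp C A A B f (Idn C A) = f"
    and Cmp_assoc:
      "\<lbrakk>A \<in> Obj C; B \<in> Obj C; D \<in> Obj C; E \<in> Obj C;
        f \<in> Hom C A B; g \<in> Hom C B D; h \<in> Hom C D E\<rbrakk>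
        \<Longrightarrow> Cmp C A D E h (Cmp C A B D g f) = Cmp C A B E (Cmp C B D E h g) f"

locale cat_functor = C: category C + D: category D
  for C :: "('o, 'm) cat" and D :: "('p, 'n) cat" +
  fixes Fo :: "'o \<Rightarrow> 'p" and Fm :: "'o \<Rightarrow> 'o \<Rightarrow> 'm \<Rightarrow> 'n"
  assumes Fo_in_Obj: "A \<in> Obj C \<Longrightarrow> Fo A \<in> Obj D"
    and Fm_in_Hom:
      "\<lbrakk>A \<in> Obj C; B \<in> Obj C; f \<in> Hom C A B\<rbrakk> \<Longrightarrow> Fm A B f \<in> Hom D (Fo A) (Fo B)"
    and Fm_Idn: "A \<in> Obj C \<Longrightarrow> Fm A A (Idn C A) = Idn D (Fo A)"
    and Fm_Cmp:
      "\<lbrakk>A \<in> Obj C; B \<in> Obj C; E \<in> Obj C; f \<in> Hom C A B; g \<in> Hom C B E\<rbrakk>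
        \<Longrightarrow> Fm A E (Cmp C A B E g f) = Cmp D (Fo A) (Fo B) (Fo E) (Fm B E g) (Fm A B f)"

locale cat_isomorphism = cat_functor C D Fo Fm
  for C :: "('o, 'm) cat" and D :: "('p, 'n) cat" and Fo Fm +
  assumes bij_Obj: "bij_betw Fo (Obj C) (Obj D)"
    and bij_Hom:
      "\<lbrakk>A \<in> Obj C; B \<in> Obj C\<rbrakk> \<Longrightarrow> bij_betw (Fm A B) (Hom C A B) (Hom D (Fo A) (Fo B))"

locale natural_transformation = F: cat_functor C D Fo Fm + G: cat_functor C D Go Gm
  for C :: "('o, 'm) cat" and D :: "('p, 'n) cat" and Fo Fm Go Gm +
  fixes \<tau> :: "'o \<Rightarrow> 'n"
  assumes component_in_Hom: "A \<in> Obj C \<Longrightarrow> \<tau> A \<in> Hom D (Fo A) (Go A)"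
    and naturality:
      "\<lbrakk>A \<in> Obj C; B \<in> Obj C; f \<in> Hom C A B\<rbrakk>
        \<Longrightarrow> Cmp D (Fo A) (Go A) (Go B) (Gm A B f) (\<tau> A)
          = Cmp D (Fo A) (Fo B) (Go B) (\<tau> B) (Fm A B f)"

locale comonad =
  counit: natural_transformation C C To Tm "\<lambda>A. A" "\<lambda>A B f. f" \<epsilon> +
  comult: natural_transformation C C To Tm
    "\<lambda>A. To (To A)" "\<lambda>A B f. Tm (To A) (To B) (Tm A B f)" \<delta>
  for C :: "('o, 'm) cat" and To Tm \<epsilon> \<delta> +
  assumes counit_left:
      "A \<in> Obj C \<Longrightarrow> Cmp C (To A) (To (To A)) (To A) (\<epsilon> (To A)) (\<delta> A) = Idn C (To A)"
    and counit_right: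
      "A \<in> Obj C \<Longrightarrow> Cmp C (To A) (To (To A)) (To A) (Tm (To A) A (\<epsilon> A)) (\<delta> A) = Idn C (To A)"
    and coassoc:
      "A \<in> Obj C \<Longrightarrow>
        Cmp C (To A) (To (To A)) (To (To (To A))) (\<delta> (To A)) (\<delta> A) =
        Cmp C (To A) (To (To A)) (To (To (To A))) (Tm (To A) (To (To A)) (\<delta> A)) (\<delta> A)"

definition Kleisli ::
  "('o, 'm) cat \<Rightarrow> ('o \<Rightarrow> 'o) \<Rightarrow> ('o \<Rightarrow> 'o \<Rightarrow> 'm \<Rightarrow> 'm) \<Rightarrow> ('o \<Rightarrow> 'm) \<Rightarrow> ('o \<Rightarrow> 'm) \<Rightarrow> ('o, 'm) cat"
  where
  "Kleisli C To Tm \<epsilon> \<delta> =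
    \<lparr> Obj = Obj C,
      Hom = (\<lambda>A B. Hom C (To A) B),
      Idn = \<epsilon>,
      Cmp = (\<lambda>A B D g f.
        Cmp C (To A) (To B) D g
          (Cmp C (To A) (To (To A)) (To B) (Tm (To A) B f) (\<delta> A))) \<rparr>"

section \<open>Distributive modules and Heyting modules\<close>

locale join_semilattice = partial_order L for L (structure) +
  assumes finite_join_exists: "\<lbrakk>finite A; A \<subseteq> carrier L\<rbrakk> \<Longrightarrow> \<exists>s. is_lub L s A"

locale distributive_lattice = bounded_lattice L for L (structure) +
  assumes meet_join_distrib:
    "\<lbrakk>x \<in> carrier L; y \<in> carrier L; z \<in> carrier L\<rbrakk> \<Longrightarrow> x \<sqinter> (y \<squnion> z) = (x \<sqinter> y) \<squnion> (x \<sqinter> z)"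

locale heyting_algebra = bounded_lattice H for H (structure) +
  assumes heyting_imp_exists:
    "\<lbrakk>y \<in> carrier H; z \<in> carrier H\<rbrakk>
      \<Longrightarrow> \<exists>w\<in>carrier H. \<forall>x\<in>carrier H. x \<sqinter> y \<sqsubseteq> z \<longleftrightarrow> x \<sqsubseteq> w"

record ('l, 'm) lmodule = "'m gorder" +
  act :: "'l \<Rightarrow> 'm \<Rightarrow> 'm" (infixr \<open>\<cdot>\<index>\<close> 72)

locale distributive_module = L: distributive_lattice L + M: join_semilattice M
  for L :: "('l, 'c) gorder_scheme" and M :: "('l, 'm, 'd) lmodule_scheme" +
  assumes act_closed: "\<lbrakk>x \<in> carrier L; m \<in> carrier M\<rbrakk> \<Longrightarrow> x \<cdot>\<^bsub>M\<^esub> m \<in> carrier M"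
    and act_mono_left:
      "\<lbrakk>x \<in> carrier L; y \<in> carrier L; m \<in> carrier M; x \<sqsubseteq>\<^bsub>L\<^esub> y\<rbrakk> \<Longrightarrow> x \<cdot>\<^bsub>M\<^esub> m \<sqsubseteq>\<^bsub>M\<^esub> y \<cdot>\<^bsub>M\<^esub> m"
    and act_mono_right:
      "\<lbrakk>x \<in> carrier L; m \<in> carrier M; n \<in> carrier M; m \<sqsubseteq>\<^bsub>M\<^esub> n\<rbrakk> \<Longrightarrow> x \<cdot>\<^bsub>M\<^esub> m \<sqsubseteq>\<^bsub>M\<^esub> x \<cdot>\<^bsub>M\<^esub> n"
    and top_act: "m \<in> carrier M \<Longrightarrow> \<top>\<^bsub>L\<^esub> \<cdot>\<^bsub>M\<^esub> m = m"
    and bottom_act: "m \<in> carrier M \<Longrightarrow> \<bottom>\<^bsub>L\<^esub> \<cdot>\<^bsub>M\<^esub> m = \<bottom>\<^bsub>M\<^esub>"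
    and meet_act:
      "\<lbrakk>x \<in> carrier L; y \<in> carrier L; m \<in> carrier M\<rbrakk>
        \<Longrightarrow> (x \<sqinter>\<^bsub>L\<^esub> y) \<cdot>\<^bsub>M\<^esub> m = x \<cdot>\<^bsub>M\<^esub> (y \<cdot>\<^bsub>M\<^esub> m)"
    and join_act:
      "\<lbrakk>x \<in> carrier L; y \<in> carrier L; m \<in> carrier M\<rbrakk>
        \<Longrightarrow> (x \<squnion>\<^bsub>L\<^esub> y) \<cdot>\<^bsub>M\<^esub> m = (x \<cdot>\<^bsub>M\<^esub> m) \<squnion>\<^bsub>M\<^esub> (y \<cdot>\<^bsub>M\<^esub> m)"
    and act_join:
      "\<lbrakk>x \<in> carrier L; m \<in> carrier M; n \<in> carrier M\<rbrakk>
        \<Longrightarrow> x \<cdot>\<^bsub>M\<^esub> (m \<squnion>\<^bsub>M\<^esub> n) = (x \<cdot>\<^bsub>M\<^esub> m) \<squnion>\<^bsub>M\<^esub> (x \<cdot>\<^bsub>M\<^esub> n)"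

locale heyting_module = H: heyting_algebra H + distributive_module H M
  for H :: "('h, 'c) gorder_scheme" and M :: "('h, 'm, 'd) lmodule_scheme" +
  assumes module_imp_exists:
    "\<lbrakk>m \<in> carrier M; n \<in> carrier M\<rbrakk>
      \<Longrightarrow> \<exists>w\<in>carrier H. \<forall>x\<in>carrier H. x \<cdot>\<^bsub>M\<^esub> m \<sqsubseteq>\<^bsub>M\<^esub> n \<longleftrightarrow> x \<sqsubseteq>\<^bsub>H\<^esub> w"

text \<open>
  Morphisms are extensional functions (undefined off the carrier of the domain), so that
  equality of morphisms is equality on the carrier. Taking \<open>A = {}\<close> gives preservation of 0.
\<close>

definition module_hom ::
  "('l, 'c) gorder_scheme \<Rightarrow> ('l, 'm, 'd) lmodule_scheme \<Rightarrow> ('l, 'n, 'e) lmodule_scheme \<Rightarrow> ('m \<Rightarrow> 'n) set"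
  where
  "module_hom L M N =
    {f \<in> carrier M \<rightarrow>\<^sub>E carrier N.
      (\<forall>A. finite A \<and> A \<subseteq> carrier M \<longrightarrow> f (\<Squnion>\<^bsub>M\<^esub> A) = \<Squnion>\<^bsub>N\<^esub> (f ` A)) \<and>
      (\<forall>x\<in>carrier L. \<forall>m\<in>carrier M. f (x \<cdot>\<^bsub>M\<^esub> m) = x \<cdot>\<^bsub>N\<^esub> f m)}"

definition hom_plus ::
  "('l, 'm, 'd) lmodule_scheme \<Rightarrow> ('l, 'n, 'e) lmodule_scheme \<Rightarrow> ('m \<Rightarrow> 'n) \<Rightarrow> ('m \<Rightarrow> 'n) \<Rightarrow> ('m \<Rightarrow> 'n)"
  where "hom_plus M N f g = (\<lambda>m\<in>carrier M. f m \<squnion>\<^bsub>N\<^esub> g m)"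

definition hom_zero ::
  "('l, 'm, 'd) lmodule_scheme \<Rightarrow> ('l, 'n, 'e) lmodule_scheme \<Rightarrow> ('m \<Rightarrow> 'n)"
  where "hom_zero M N = (\<lambda>m\<in>carrier M. \<bottom>\<^bsub>N\<^esub>)"

text \<open>
  The objects of \<open>Heymod H\<close> are the Heyting modules whose underlying set is a subset of the
  type \<open>'u\<close>, which plays the role of the universe of sets.
\<close>

definition Heymod :: "'h gorder \<Rightarrow> (('h, 'u) lmodule, 'u \<Rightarrow> 'u) cat" where
  "Heymod H =
    \<lparr> Obj = {M. heyting_module H M},
      Hom = module_hom H,
      Idn = (\<lambda>M. \<lambda>m\<in>carrier M. m),
      Cmp = (\<lambda>M N P g f. compose (carrier M) g f) \<rparr>"

definition Heymod2 :: "'h gorder \<Rightarrow> (('h, 'u) lmodule, ('u \<Rightarrow> 'u) \<times> ('u \<Rightarrow> 'u)) cat" where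
  "Heymod2 H =
    \<lparr> Obj = Obj (Heymod H),
      Hom = (\<lambda>M N. Hom (Heymod H) M N \<times> Hom (Heymod H) M N),
      Idn = (\<lambda>M. (Idn (Heymod H) M, hom_zero M M)),
      Cmp = (\<lambda>M N P (f', g') (f, g).
        (hom_plus M P (Cmp (Heymod H) M N P f' f) (Cmp (Heymod H) M N P g' g),
         hom_plus M P (Cmp (Heymod H) M N P f' g) (Cmp (Heymod H) M N P g' f))) \<rparr>"

section \<open>The squaring comonad\<close>

text \<open>
  For the square of a module on \<open>'u\<close> to be a module on \<open>'u\<close> again, ordered pairs are encoded
  as elements of \<open>'u\<close> by an injection \<open>pr\<close>, as ordered pairs are encoded as sets in set theory.
  Such an injection exists on every infinite type.
\<close>

definition pfst :: "('u \<times> 'u \<Rightarrow> 'u) \<Rightarrow> 'u \<Rightarrow> 'u" where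
  "pfst pr p = fst (inv pr p)"

definition psnd :: "('u \<times> 'u \<Rightarrow> 'u) \<Rightarrow> 'u \<Rightarrow> 'u" where
  "psnd pr p = snd (inv pr p)"

definition square :: "('u \<times> 'u \<Rightarrow> 'u) \<Rightarrow> ('h, 'u) lmodule \<Rightarrow> ('h, 'u) lmodule" where
  "square pr M =
    \<lparr> carrier = pr ` (carrier M \<times> carrier M),
      eq = (=),
      le = (\<lambda>p q. pfst pr p \<sqsubseteq>\<^bsub>M\<^esub> pfst pr q \<and> psnd pr p \<sqsubseteq>\<^bsub>M\<^esub> psnd pr q),
      act = (\<lambda>x p. pr (x \<cdot>\<^bsub>M\<^esub> pfst pr p, x \<cdot>\<^bsub>M\<^esub> psnd pr p)) \<rparr>"

definition square_map ::
  "('u \<times> 'u \<Rightarrow> 'u) \<Rightarrow> ('h, 'u) lmodule \<Rightarrow> ('h, 'u) lmodule \<Rightarrow> ('u \<Rightarrow> 'u) \<Rightarrow> ('u \<Rightarrow> 'u)" where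
  "square_map pr M N f = (\<lambda>p\<in>carrier (square pr M). pr (f (pfst pr p), f (psnd pr p)))"

definition square_counit :: "('u \<times> 'u \<Rightarrow> 'u) \<Rightarrow> ('h, 'u) lmodule \<Rightarrow> ('u \<Rightarrow> 'u)" where
  "square_counit pr M = (\<lambda>p\<in>carrier (square pr M). pfst pr p)"

definition square_comult :: "('u \<times> 'u \<Rightarrow> 'u) \<Rightarrow> ('h, 'u) lmodule \<Rightarrow> ('u \<Rightarrow> 'u)" where
  "square_comult pr M =
    (\<lambda>p\<in>carrier (square pr M). pr (pr (pfst pr p, psnd pr p), pr (psnd pr p, pfst pr p)))"

text \<open>The morphism \<open>(m, n) \<mapsto> f(m) \<or> g(n)\<close> from \<open>M\<^sup>2\<close> to \<open>N\<close>.\<close>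

definition copair ::
  "('u \<times> 'u \<Rightarrow> 'u) \<Rightarrow> ('h, 'u) lmodule \<Rightarrow> ('h, 'u) lmodule
    \<Rightarrow> ('u \<Rightarrow> 'u) \<times> ('u \<Rightarrow> 'u) \<Rightarrow> ('u \<Rightarrow> 'u)" where
  "copair pr M N = (\<lambda>(f, g). \<lambda>p\<in>carrier (square pr M). f (pfst pr p) \<squnion>\<^bsub>N\<^esub> g (psnd pr p))"

end

theory Submission
  imports Defs
begin

text \<open>
  \<open>M\<^sup>2\<close> is also a coproduct: \<open>(m, n) = (m, 0) \<or> (0, n)\<close>, so a morphism \<open>M\<^sup>2 \<rightarrow> N\<close> is determined by its
  restrictions to the two factors. Evaluating a Kleisli composite at \<open>(m, n)\<close> duplicates the
  argument to \<open>((m, n), (n, m))\<close>, sends it to \<open>(f m \<or> g n, f n \<or> g m)\<close> and then to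
  \<open>f' (f m \<or> g n) \<or> g' (f n \<or> g m)\<close>. Regrouping the terms in \<open>m\<close> and in \<open>n\<close> gives the composition
  of \<open>Heymod\<^sup>2\<close>.
\<close>

section \<open>Categories\<close>

text \<open>The codomain of the counit is the identity functor, and that of the comultiplication is
  an iterated functor. This lemma and the next one supply both.\<close>

lemma (in category) cat_functor_id: "cat_functor C C (\<lambda>A. A) (\<lambda>A B f. f)"
  by unfold_locales simp_all

lemma cat_functor_comp:
  assumes "cat_functor C D Fo Fm" and "cat_functor D E Go Gm"
  shows "cat_functor C E (\<lambda>A. Go (Fo A)) (\<lambda>A B f. Gm (Fo A) (Fo B) (Fm A B f))"
proof -
  interpret F: cat_functor C D Fo Fm by fact
  interpret G: cat_functor D E Go Gm by fact
  show ?thesis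
    by unfold_locales
      (simp_all add: F.Fo_in_Obj G.Fo_in_Obj F.Fm_in_Hom G.Fm_in_Hom F.Fm_Idn G.Fm_Idn
        F.Fm_Cmp G.Fm_Cmp)
qed

text \<open>The category laws of the source hold because they are reflected along the bijections.\<close>

lemma cat_isomorphismI:
  assumes "category D"
    and bij_Obj: "bij_betw Fo (Obj C) (Obj D)"
    and bij_Hom: "\<And>A B. \<lbrakk>A \<in> Obj C; B \<in> Obj C\<rbrakk>
      \<Longrightarrow> bij_betw (Fm A B) (Hom C A B) (Hom D (Fo A) (Fo B))"
    and Idn: "\<And>A. A \<in> Obj C \<Longrightarrow> Idn C A \<in> Hom C A A"
    and Cmp: "\<And>A B E f g. \<lbrakk>A \<in> Obj C; B \<in> Obj C; E \<in> Obj C; f \<in> Hom C A B; g \<in> Hom C B E\<rbrakk>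
      \<Longrightarrow> Cmp C A B E g f \<in> Hom C A E"
    and Fm_Idn: "\<And>A. A \<in> Obj C \<Longrightarrow> Fm A A (Idn C A) = Idn D (Fo A)"
    and Fm_Cmp: "\<And>A B E f g. \<lbrakk>A \<in> Obj C; B \<in> Obj C; E \<in> Obj C; f \<in> Hom C A B; g \<in> Hom C B E\<rbrakk>
      \<Longrightarrow> Fm A E (Cmp C A B E g f) = Cmp D (Fo A) (Fo B) (Fo E) (Fm B E g) (Fm A B f)"
  shows "cat_isomorphism C D Fo Fm"
proof -
  interpret D: category D by fact
  have Fo: "Fo A \<in> Obj D" if "A \<in> Obj C" for A
    using bij_Obj that by (rule bij_betw_apply)
  have Fm: "Fm A B f \<in> Hom D (Fo A) (Fo B)" if "A \<in> Obj C" "B \<in> Obj C" "f \<in> Hom C A B" for A B f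
    using bij_Hom[OF that(1,2)] that(3) by (rule bij_betw_apply)
  have inj: "f = g"
    if "Fm A B f = Fm A B g" "A \<in> Obj C" "B \<in> Obj C" "f \<in> Hom C A B" "g \<in> Hom C A B" for A B f g
    using bij_betw_imp_inj_on[OF bij_Hom[OF that(2,3)]] that by (simp add: inj_on_eq_iff)
  interpret C: category C
  proof
    fix A B f assume *: "A \<in> Obj C" "B \<in> Obj C" "f \<in> Hom C A B"
    show "Cmp C A B B (Idn C B) f = f"
      by (rule inj[where A = A and B = B])
        (simp_all add: * Idn Cmp Fm_Idn Fm_Cmp Fo Fm D.Cmp_Idn_left)
    show "Cmp C A A B f (Idn C A) = f"
      by (rule inj[where A = A and B = B])
        (simp_all add: * Idn Cmp Fm_Idn Fm_Cmp Fo Fm D.Cmp_Idn_right)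
  next
    fix A B D' E f g h
    assume *: "A \<in> Obj C" "B \<in> Obj C" "D' \<in> Obj C" "E \<in> Obj C"
      "f \<in> Hom C A B" "g \<in> Hom C B D'" "h \<in> Hom C D' E"
    have c: "Cmp C A B D' g f \<in> Hom C A D'" "Cmp C B D' E h g \<in> Hom C B E"
      using * Cmp by blast+
    show "Cmp C A D' E h (Cmp C A B D' g f) = Cmp C A B E (Cmp C B D' E h g) f"
    proof (rule inj[where A = A and B = E])
      show "Fm A E (Cmp C A D' E h (Cmp C A B D' g f)) = Fm A E (Cmp C A B E (Cmp C B D' E h g) f)"
        using * c by (simp add: Fm_Cmp Fo Fm D.Cmp_assoc)
    qed (use * c Cmp in blast)+
  qed (use Idn Cmp in blast)+
  show ?thesis
    by unfold_locales (use Fo Fm Fm_Idn Fm_Cmp bij_Obj bij_Hom in blast)+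
qed

text \<open>The left identity law combines naturality of \<epsilon> with \<open>counit_left\<close>,
  and the right one is \<open>counit_right\<close> itself. Associativity combines functoriality,
  \<open>coassoc\<close> and naturality of \<delta>.\<close>

lemma (in comonad) category_Kleisli: "category (Kleisli C To Tm \<epsilon> \<delta>)"
proof -
  note [simp] = counit.F.Fo_in_Obj counit.F.Fm_in_Hom counit.F.C.Cmp_in_Hom
    counit.component_in_Hom comult.component_in_Hom
  show ?thesis
  proof (unfold_locales, simp_all add: Kleisli_def)
    fix A B f assume *: "A \<in> Obj C" "B \<in> Obj C" "f \<in> Hom C (To A) B"
    have "Cmp C (To A) (To B) B (\<epsilon> B) (Cmp C (To A) (To (To A)) (To B) (Tm (To A) B f) (\<delta> A))
        = Cmp C (To A) (To (To A)) B (Cmp C (To (To A)) (To B) B (\<epsilon> B) (Tm (To A) B f)) (\<delta> A)"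
      using * by (intro counit.F.C.Cmp_assoc) simp_all
    also have "\<dots> = Cmp C (To A) (To (To A)) B (Cmp C (To (To A)) (To A) B f (\<epsilon> (To A))) (\<delta> A)"
      using * counit.naturality[of "To A" B f] by simp
    also have "\<dots> = Cmp C (To A) (To A) B f (Cmp C (To A) (To (To A)) (To A) (\<epsilon> (To A)) (\<delta> A))"
      using * by (intro counit.F.C.Cmp_assoc[symmetric]) simp_all
    also have "\<dots> = f"
      using * by (simp add: counit_left counit.F.C.Cmp_Idn_right)
    finally show "Cmp C (To A) (To B) B (\<epsilon> B)
        (Cmp C (To A) (To (To A)) (To B) (Tm (To A) B f) (\<delta> A)) = f" .
    show "Cmp C (To A) (To A) B f
        (Cmp C (To A) (To (To A)) (To A) (Tm (To A) A (\<epsilon> A)) (\<delta> A)) = f"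
      using * by (simp add: counit_right counit.F.C.Cmp_Idn_right)
  next
    fix A B D E f g h
    assume *: "A \<in> Obj C" "B \<in> Obj C" "D \<in> Obj C" "E \<in> Obj C"
      "f \<in> Hom C (To A) B" "g \<in> Hom C (To B) D" "h \<in> Hom C (To D) E"
    let ?Tf = "Tm (To A) B f" and ?Tg = "Tm (To B) D g"
    let ?TTf = "Tm (To (To A)) (To B) ?Tf"
    let ?f = "Cmp C (To A) (To (To A)) (To B) ?Tf (\<delta> A)"
    \<comment> \<open>The functor is pushed through the whole Kleisli composite, which leaves the
      lifted \<delta> innermost. Composed with \<open>\<delta> A\<close>, it forms one side of
      \<open>coassoc\<close>.\<close>
    have "Tm (To A) D (Cmp C (To A) (To B) D g ?f)
        = Cmp C (To (To A)) (To (To B)) (To D) ?Tg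
            (Cmp C (To (To A)) (To (To (To A))) (To (To B)) ?TTf (Tm (To A) (To (To A)) (\<delta> A)))"
      using * by (simp add: counit.F.Fm_Cmp)
    then have "Cmp C (To A) (To (To A)) (To D) (Tm (To A) D (Cmp C (To A) (To B) D g ?f)) (\<delta> A)
        = Cmp C (To A) (To (To B)) (To D) ?Tg
            (Cmp C (To A) (To (To (To A))) (To (To B)) ?TTf
              (Cmp C (To A) (To (To A)) (To (To (To A))) (Tm (To A) (To (To A)) (\<delta> A)) (\<delta> A)))"
      using * by (simp add: counit.F.C.Cmp_assoc[symmetric])
    also have "\<dots> = Cmp C (To A) (To (To B)) (To D) ?Tg
            (Cmp C (To A) (To (To (To A))) (To (To B)) ?TTf
              (Cmp C (To A) (To (To A)) (To (To (To A))) (\<delta> (To A)) (\<delta> A)))"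
      using * by (simp add: coassoc)
    \<comment> \<open>Rebracketing puts \<open>?TTf\<close> directly after
      \<open>\<delta> (To A)\<close>, so that naturality of \<delta> at \<open>f\<close> can replace
      the pair by \<open>\<delta> B\<close> after \<open>?Tf\<close>.\<close>
    also have "\<dots> = Cmp C (To A) (To (To B)) (To D) ?Tg
            (Cmp C (To A) (To (To A)) (To (To B))
              (Cmp C (To (To A)) (To (To (To A))) (To (To B)) ?TTf (\<delta> (To A))) (\<delta> A))"
      using * by (simp add: counit.F.C.Cmp_assoc)
    also have "\<dots> = Cmp C (To A) (To (To B)) (To D) ?Tg
            (Cmp C (To A) (To (To A)) (To (To B))
              (Cmp C (To (To A)) (To B) (To (To B)) (\<delta> B) ?Tf) (\<delta> A))"
      using * comult.naturality[of "To A" B f] by simp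
    also have "\<dots> = Cmp C (To A) (To B) (To D) (Cmp C (To B) (To (To B)) (To D) ?Tg (\<delta> B)) ?f"
      using * by (simp add: counit.F.C.Cmp_assoc[symmetric])
    finally show "Cmp C (To A) (To D) E h
        (Cmp C (To A) (To (To A)) (To D) (Tm (To A) D (Cmp C (To A) (To B) D g ?f)) (\<delta> A)) =
      Cmp C (To A) (To B) E
        (Cmp C (To B) (To D) E h (Cmp C (To B) (To (To B)) (To D) ?Tg (\<delta> B))) ?f"
      using * by (simp add: counit.F.C.Cmp_assoc)
  qed
qed

section \<open>Join semilattices and module morphisms\<close>

context join_semilattice
begin

sublocale upper_semilattice L
  by unfold_locales (simp add: finite_join_exists)

sublocale weak_partial_order_bottom L
  by unfold_locales (use finite_join_exists[of "{}"] in simp)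

lemma join_assoc:
  "\<lbrakk>x \<in> carrier L; y \<in> carrier L; z \<in> carrier L\<rbrakk> \<Longrightarrow> (x \<squnion> y) \<squnion> z = x \<squnion> (y \<squnion> z)"
  using weak_join_assoc by (simp add: eq_is_equal)

lemma join_left_comm:
  "\<lbrakk>x \<in> carrier L; y \<in> carrier L; z \<in> carrier L\<rbrakk> \<Longrightarrow> x \<squnion> (y \<squnion> z) = y \<squnion> (x \<squnion> z)"
  by (metis join_assoc join_comm)

lemma bottom_join [simp]: "x \<in> carrier L \<Longrightarrow> \<bottom> \<squnion> x = x"
  by (intro le_antisym join_le join_right) simp_all

lemma join_bottom [simp]: "x \<in> carrier L \<Longrightarrow> x \<squnion> \<bottom> = x"
  by (simp add: join_comm[of L x])

lemma finite_Sup_is_lub: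
  assumes "finite A" "A \<subseteq> carrier L"
  shows "is_lub L (\<Squnion>A) A"
  using finite_join_exists[OF assms] unfolding Lattice.sup_def by (rule someI_ex)

text \<open>The supremum is a Hilbert choice among least upper bounds. In a partial order there is
  at most one, so exhibiting any least upper bound computes it.\<close>

lemma Sup_eqI: "is_lub L s A \<Longrightarrow> \<Squnion>A = s"
  unfolding Lattice.sup_def by (rule some_equality) (blast intro: least_unique)+

lemma bottom_eqI: "\<lbrakk>b \<in> carrier L; \<And>x. x \<in> carrier L \<Longrightarrow> b \<sqsubseteq> x\<rbrakk> \<Longrightarrow> \<bottom> = b"
  by (intro le_antisym) simp_all

lemma Sup_empty: "\<Squnion>{} = \<bottom>"
  by (simp add: Lattice.sup_def bottom_def)

text \<open>The recursion that reduces finite joins to \<bottom> and binary joins.\<close>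

lemma Sup_insert:
  assumes "finite A" "A \<subseteq> carrier L" "x \<in> carrier L"
  shows "\<Squnion>(insert x A) = x \<squnion> \<Squnion>A"
proof (rule Sup_eqI, rule least_UpperI)
  note A = finite_Sup_is_lub[OF assms(1,2)]
  then have c: "\<Squnion>A \<in> carrier L" by simp
  then show "x \<squnion> \<Squnion>A \<in> carrier L" "insert x A \<subseteq> carrier L"
    using assms by simp_all
  show "z \<sqsubseteq> x \<squnion> \<Squnion>A" if "z \<in> insert x A" for z
    using that assms c
    by (auto intro: join_left join_right le_trans[OF least_Upper_above[OF A]])
  show "x \<squnion> \<Squnion>A \<sqsubseteq> y" if "y \<in> Upper L (insert x A)" for y
  proof -
    have "y \<in> Upper L A"
      using that Upper_antimono[of A "insert x A" L] by blast
    with that assms c show ?thesis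
      by (intro join_le least_le[OF A]) auto
  qed
qed

end

text \<open>The axiom \<open>act_join\<close> covers binary joins only, so the empty join needs its
  own argument. Write the zero of \<open>M\<close> as the zero of \<open>L\<close> acting on it.
  Then \<open>meet_act\<close> merges \<open>x\<close> with that zero into the zero of
  \<open>L\<close>.\<close>

lemma (in distributive_module) act_bottom:
  assumes "x \<in> carrier L"
  shows "x \<cdot>\<^bsub>M\<^esub> \<bottom>\<^bsub>M\<^esub> = \<bottom>\<^bsub>M\<^esub>"
proof -
  have "x \<sqinter>\<^bsub>L\<^esub> \<bottom>\<^bsub>L\<^esub> = \<bottom>\<^bsub>L\<^esub>"
    using L.bottom_meet[OF assms] by (simp add: meet_comm[of L x] L.eq_is_equal)
  then show ?thesis
    using meet_act[of x "\<bottom>\<^bsub>L\<^esub>" "\<bottom>\<^bsub>M\<^esub>"] assms by (simp add: bottom_act)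
qed

text \<open>Preservation of all finite joins is equivalent to preservation of the empty and the
  binary ones. The instances \<open>{}\<close> and \<open>{m, n}\<close> give one direction, and
  induction on the finite set gives the other.\<close>

lemma module_hom_iff:
  assumes "join_semilattice M" and "join_semilattice N"
  shows "f \<in> module_hom L M N \<longleftrightarrow>
    f \<in> carrier M \<rightarrow>\<^sub>E carrier N \<and> f \<bottom>\<^bsub>M\<^esub> = \<bottom>\<^bsub>N\<^esub> \<and>
    (\<forall>m\<in>carrier M. \<forall>n\<in>carrier M. f (m \<squnion>\<^bsub>M\<^esub> n) = f m \<squnion>\<^bsub>N\<^esub> f n) \<and>
    (\<forall>x\<in>carrier L. \<forall>m\<in>carrier M. f (x \<cdot>\<^bsub>M\<^esub> m) = x \<cdot>\<^bsub>N\<^esub> f m)"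
proof -
  interpret M: join_semilattice M by fact
  interpret N: join_semilattice N by fact
  have "(\<forall>A. finite A \<and> A \<subseteq> carrier M \<longrightarrow> f (\<Squnion>\<^bsub>M\<^esub> A) = \<Squnion>\<^bsub>N\<^esub> (f ` A)) \<longleftrightarrow>
      f \<bottom>\<^bsub>M\<^esub> = \<bottom>\<^bsub>N\<^esub> \<and> (\<forall>m\<in>carrier M. \<forall>n\<in>carrier M. f (m \<squnion>\<^bsub>M\<^esub> n) = f m \<squnion>\<^bsub>N\<^esub> f n)"
    (is "?S \<longleftrightarrow> ?B") if f: "f \<in> carrier M \<rightarrow> carrier N"
  proof
    assume S: ?S
    have "f (m \<squnion>\<^bsub>M\<^esub> n) = f m \<squnion>\<^bsub>N\<^esub> f n" if "m \<in> carrier M" "n \<in> carrier M" for m n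
      using S[rule_format, of "{m, n}"] that by (simp add: join_def)
    then show ?B
      using S[rule_format, of "{}"] by (simp add: M.Sup_empty N.Sup_empty)
  next
    assume B: ?B
    have "f (\<Squnion>\<^bsub>M\<^esub> A) = \<Squnion>\<^bsub>N\<^esub> (f ` A)" if "finite A" "A \<subseteq> carrier M" for A
      using that
    proof (induction A rule: finite_induct)
      case empty
      then show ?case using B by (simp add: M.Sup_empty N.Sup_empty)
    next
      case (insert x A)
      then have "\<Squnion>\<^bsub>M\<^esub> A \<in> carrier M"
        using M.finite_Sup_is_lub[of A] by simp
      moreover have "f ` A \<subseteq> carrier N" "f x \<in> carrier N"
        using f insert.prems by auto
      ultimately show ?case
        using insert B by (simp add: M.Sup_insert N.Sup_insert)
    qed
    then show ?S by blast
  qed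
  then show ?thesis
    unfolding module_hom_def by (auto simp: PiE_def)
qed

section \<open>The category of Heyting modules\<close>

lemma heyting_module_join_semilattice: "heyting_module H M \<Longrightarrow> join_semilattice M"
  by (simp add: heyting_module_def distributive_module_def)

lemma Obj_Heymod [simp]: "M \<in> Obj (Heymod H) \<longleftrightarrow> heyting_module H M"
  by (simp add: Heymod_def)

lemma Idn_Heymod [simp]: "Idn (Heymod H) M = (\<lambda>m\<in>carrier M. m)"
  by (simp add: Heymod_def)

lemma Cmp_Heymod [simp]: "Cmp (Heymod H) M N P g f = compose (carrier M) g f"
  by (simp add: Heymod_def)

lemma Hom_Heymod_iff:
  assumes "heyting_module H M" and "heyting_module H N"
  shows "f \<in> Hom (Heymod H) M N \<longleftrightarrow>
    f \<in> carrier M \<rightarrow>\<^sub>E carrier N \<and> f \<bottom>\<^bsub>M\<^esub> = \<bottom>\<^bsub>N\<^esub> \<and>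
    (\<forall>m\<in>carrier M. \<forall>n\<in>carrier M. f (m \<squnion>\<^bsub>M\<^esub> n) = f m \<squnion>\<^bsub>N\<^esub> f n) \<and>
    (\<forall>x\<in>carrier H. \<forall>m\<in>carrier M. f (x \<cdot>\<^bsub>M\<^esub> m) = x \<cdot>\<^bsub>N\<^esub> f m)"
  using assms by (simp add: Heymod_def module_hom_iff heyting_module_join_semilattice)

lemma Hom_Heymod_closed:
  "\<lbrakk>f \<in> Hom (Heymod H) M N; m \<in> carrier M\<rbrakk> \<Longrightarrow> f m \<in> carrier N"
  by (auto simp: Heymod_def module_hom_def)

lemma Hom_Heymod_extensional: "f \<in> Hom (Heymod H) M N \<Longrightarrow> f \<in> extensional (carrier M)"
  by (auto simp: Heymod_def module_hom_def PiE_def)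

lemma Hom_Heymod_eqI:
  "\<lbrakk>f \<in> Hom (Heymod H) M N; g \<in> Hom (Heymod H) M N; \<And>m. m \<in> carrier M \<Longrightarrow> f m = g m\<rbrakk> \<Longrightarrow> f = g"
  by (rule extensionalityI[OF Hom_Heymod_extensional Hom_Heymod_extensional])

lemma compose_in_Hom_Heymod:
  assumes "heyting_module H M" "heyting_module H N" "heyting_module H P"
    and "f \<in> Hom (Heymod H) M N" "g \<in> Hom (Heymod H) N P"
  shows "compose (carrier M) g f \<in> Hom (Heymod H) M P"
proof -
  interpret M: heyting_module H M by fact
  have "f m \<in> carrier N" if "m \<in> carrier M" for m
    using that Hom_Heymod_closed[OF assms(4)] by simp
  then show ?thesis
    using assms(4,5)
    by (auto simp: Hom_Heymod_iff assms(1-3) compose_eq M.act_closed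
        intro!: PiE_I dest: PiE_mem) (auto simp: compose_def)
qed

lemma identity_in_Hom_Heymod:
  assumes "heyting_module H M"
  shows "(\<lambda>m\<in>carrier M. m) \<in> Hom (Heymod H) M M"
proof -
  interpret M: heyting_module H M by fact
  show ?thesis
    by (simp add: Hom_Heymod_iff assms M.act_closed)
qed

text \<open>\<open>compose\<close> restricts every composite to the carrier of its domain, so each
  law reduces to an equation on that carrier. The identity laws also use that \<open>f\<close> is
  extensional.\<close>

lemma category_Heymod: "category (Heymod H)"
proof
  fix M N P Q and f g h
  assume M: "M \<in> Obj (Heymod H)" and N: "N \<in> Obj (Heymod H)" and f: "f \<in> Hom (Heymod H) M N"
  show "Cmp (Heymod H) M N N (Idn (Heymod H) N) f = f"
    "Cmp (Heymod H) M M N f (Idn (Heymod H) M) = f"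
    using f Hom_Heymod_closed[OF f] Hom_Heymod_extensional[OF f]
    by (auto intro!: extensionalityI[of _ "carrier M"] simp: compose_eq)
  assume g: "g \<in> Hom (Heymod H) N P"
  show "Cmp (Heymod H) M P Q h (Cmp (Heymod H) M N P g f)
      = Cmp (Heymod H) M N Q (Cmp (Heymod H) N P Q h g) f"
    using Hom_Heymod_closed[OF f]
    by (auto intro!: extensionalityI[of _ "carrier M"] simp: compose_eq)
qed (simp_all add: identity_in_Hom_Heymod compose_in_Hom_Heymod)

lemma hom_zero_in_Hom:
  assumes "heyting_module H M" "heyting_module H N"
  shows "hom_zero M N \<in> Hom (Heymod H) M N"
proof -
  interpret M: heyting_module H M by fact
  interpret N: heyting_module H N by fact
  show ?thesis
    by (simp add: Hom_Heymod_iff assms hom_zero_def M.act_closed N.act_bottom)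
qed

text \<open>Preservation of joins is a regrouping of four terms, and compatibility with the action
  is \<open>act_join\<close> in \<open>N\<close>.\<close>

lemma hom_plus_in_Hom:
  assumes "heyting_module H M" "heyting_module H N"
    and "f \<in> Hom (Heymod H) M N" "g \<in> Hom (Heymod H) M N"
  shows "hom_plus M N f g \<in> Hom (Heymod H) M N"
proof -
  interpret M: heyting_module H M by fact
  interpret N: heyting_module H N by fact
  have "f m \<in> carrier N" "g m \<in> carrier N" if "m \<in> carrier M" for m
    using that Hom_Heymod_closed[OF assms(3)] Hom_Heymod_closed[OF assms(4)] by simp_all
  with assms(3,4) show ?thesis
    by (simp add: Hom_Heymod_iff assms(1,2) hom_plus_def M.act_closed N.act_join
        N.M.join_assoc N.M.join_left_comm join_comm)
qed

section \<open>The squaring comonad\<close>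

text \<open>Injectivity makes \<open>pfst\<close> and \<open>psnd\<close> correct on values of
  \<open>pr\<close>, and the carrier of a square consists of such values. Facts about squares are
  therefore stated at arguments \<open>pr (a, b)\<close> where possible.\<close>

locale pairing =
  fixes pr :: "'u \<times> 'u \<Rightarrow> 'u"
  assumes inj_pr: "inj pr"
begin

lemma pfst_pr [simp]: "pfst pr (pr (a, b)) = a"
  by (simp add: pfst_def inv_f_f inj_pr)

lemma psnd_pr [simp]: "psnd pr (pr (a, b)) = b"
  by (simp add: psnd_def inv_f_f inj_pr)

lemma pr_eq_iff [simp]: "pr p = pr q \<longleftrightarrow> p = q"
  by (simp add: inj_eq inj_pr)

lemma pr_in_square [simp]:
  "pr (a, b) \<in> carrier (square pr M) \<longleftrightarrow> a \<in> carrier M \<and> b \<in> carrier M"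
  by (auto simp: square_def)

lemma in_squareE:
  assumes "p \<in> carrier (square pr M)"
  obtains a b where "p = pr (a, b)" "a \<in> carrier M" "b \<in> carrier M"
  using assms by (auto simp: square_def)

lemma ball_square:
  "(\<forall>p\<in>carrier (square pr M). P p) \<longleftrightarrow> (\<forall>a\<in>carrier M. \<forall>b\<in>carrier M. P (pr (a, b)))"
  by (auto simp: square_def)

lemma square_le [simp]: "pr (a, b) \<sqsubseteq>\<^bsub>square pr M\<^esub> pr (c, d) \<longleftrightarrow> a \<sqsubseteq>\<^bsub>M\<^esub> c \<and> b \<sqsubseteq>\<^bsub>M\<^esub> d"
  by (simp add: square_def)

lemma square_act [simp]: "x \<cdot>\<^bsub>square pr M\<^esub> pr (a, b) = pr (x \<cdot>\<^bsub>M\<^esub> a, x \<cdot>\<^bsub>M\<^esub> b)"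
  by (simp add: square_def)

section \<open>The square of a Heyting module\<close>

lemma partial_order_square:
  assumes "partial_order M"
  shows "partial_order (square pr M)"
proof -
  interpret M: partial_order M by fact
  have eq: "eq (square pr M) = (=)" by (simp add: square_def)
  show ?thesis
  proof (unfold_locales, unfold eq)
    fix x y z
    assume c: "x \<in> carrier (square pr M)" "y \<in> carrier (square pr M)" "z \<in> carrier (square pr M)"
    assume "x \<sqsubseteq>\<^bsub>square pr M\<^esub> y" "y \<sqsubseteq>\<^bsub>square pr M\<^esub> z"
    with c show "x \<sqsubseteq>\<^bsub>square pr M\<^esub> z"
      by (auto elim!: in_squareE intro: M.le_trans)
  qed (auto elim!: in_squareE)
qed

text \<open>An upper bound of \<open>A\<close> is a pair of upper bounds of its two projections, so
  least upper bounds are formed componentwise. This gives both the existence of finite joins in the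
  square and the formula for binary joins.\<close>

lemma is_lub_square:
  assumes A: "A \<subseteq> carrier (square pr M)"
    and s: "is_lub M s (pfst pr ` A)" and t: "is_lub M t (psnd pr ` A)"
  shows "is_lub (square pr M) (pr (s, t)) A"
proof (rule least_UpperI)
  have im: "pfst pr ` A \<subseteq> carrier M" "psnd pr ` A \<subseteq> carrier M"
    using A by (auto elim!: in_squareE dest!: subsetD)
  show "p \<sqsubseteq>\<^bsub>square pr M\<^esub> pr (s, t)" if "p \<in> A" for p
    using that A least_Upper_above[OF s _ im(1)] least_Upper_above[OF t _ im(2)]
    by (force elim!: in_squareE dest!: subsetD)
  show "pr (s, t) \<sqsubseteq>\<^bsub>square pr M\<^esub> q" if q: "q \<in> Upper (square pr M) A" for q
  proof -
    from q obtain a b where ab: "q = pr (a, b)" "a \<in> carrier M" "b \<in> carrier M"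
      by (auto simp: Upper_def elim: in_squareE)
    have "pfst pr p \<sqsubseteq>\<^bsub>M\<^esub> a \<and> psnd pr p \<sqsubseteq>\<^bsub>M\<^esub> b" if "p \<in> A" for p
      using that A q ab(1) unfolding Upper_def by (force elim!: in_squareE dest!: subsetD)
    then have "a \<in> Upper M (pfst pr ` A)" "b \<in> Upper M (psnd pr ` A)"
      using ab by (auto simp: Upper_def)
    then show ?thesis
      using ab least_le[OF s] least_le[OF t] by simp
  qed
qed (use A s t in auto)

lemma join_semilattice_square:
  assumes "join_semilattice M"
  shows "join_semilattice (square pr M)"
proof -
  interpret M: join_semilattice M by fact
  interpret S: partial_order "square pr M"
    by (rule partial_order_square) unfold_locales
  show ?thesis
  proof
    fix A assume A: "finite A" "A \<subseteq> carrier (square pr M)"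
    then have "pfst pr ` A \<subseteq> carrier M" "psnd pr ` A \<subseteq> carrier M"
      by (auto elim!: in_squareE dest!: subsetD)
    with A have "is_lub (square pr M) (pr (\<Squnion>\<^bsub>M\<^esub> (pfst pr ` A), \<Squnion>\<^bsub>M\<^esub> (psnd pr ` A))) A"
      by (intro is_lub_square M.finite_Sup_is_lub) simp_all
    then show "\<exists>s. is_lub (square pr M) s A" ..
  qed
qed

lemma square_join:
  assumes "join_semilattice M"
    and "a \<in> carrier M" "b \<in> carrier M" "c \<in> carrier M" "d \<in> carrier M"
  shows "pr (a, b) \<squnion>\<^bsub>square pr M\<^esub> pr (c, d) = pr (a \<squnion>\<^bsub>M\<^esub> c, b \<squnion>\<^bsub>M\<^esub> d)"
proof -
  interpret M: join_semilattice M by fact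
  interpret S: join_semilattice "square pr M"
    by (rule join_semilattice_square) fact
  show ?thesis
    unfolding join_def
    by (rule S.Sup_eqI, rule is_lub_square) (use assms M.finite_Sup_is_lub in simp_all)
qed

lemma square_bottom:
  assumes "join_semilattice M"
  shows "\<bottom>\<^bsub>square pr M\<^esub> = pr (\<bottom>\<^bsub>M\<^esub>, \<bottom>\<^bsub>M\<^esub>)"
proof -
  interpret M: join_semilattice M by fact
  interpret S: join_semilattice "square pr M"
    by (rule join_semilattice_square) fact
  show ?thesis
    by (rule S.bottom_eqI) (auto elim!: in_squareE)
qed

text \<open>The module axioms hold componentwise. The implication between two pairs is the meet in
  \<open>H\<close> of the implications between their coordinates.\<close>

lemma heyting_module_square:
  assumes "heyting_module H M"
  shows "heyting_module H (square pr M)"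
proof -
  interpret M: heyting_module H M by fact
  have jM: "join_semilattice M" by unfold_locales
  interpret S: join_semilattice "square pr M"
    using jM by (rule join_semilattice_square)
  show ?thesis
  proof
    fix p q
    assume pq: "p \<in> carrier (square pr M)" "q \<in> carrier (square pr M)"
    from pq(1) obtain a b where p: "p = pr (a, b)" "a \<in> carrier M" "b \<in> carrier M"
      by (rule in_squareE)
    from pq(2) obtain c d where q: "q = pr (c, d)" "c \<in> carrier M" "d \<in> carrier M"
      by (rule in_squareE)
    obtain v where v: "v \<in> carrier H" "\<forall>x\<in>carrier H. x \<cdot>\<^bsub>M\<^esub> a \<sqsubseteq>\<^bsub>M\<^esub> c \<longleftrightarrow> x \<sqsubseteq>\<^bsub>H\<^esub> v"
      using M.module_imp_exists[OF p(2) q(2)] by blast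
    obtain w where w: "w \<in> carrier H" "\<forall>x\<in>carrier H. x \<cdot>\<^bsub>M\<^esub> b \<sqsubseteq>\<^bsub>M\<^esub> d \<longleftrightarrow> x \<sqsubseteq>\<^bsub>H\<^esub> w"
      using M.module_imp_exists[OF p(3) q(3)] by blast
    have "x \<sqsubseteq>\<^bsub>H\<^esub> v \<sqinter>\<^bsub>H\<^esub> w \<longleftrightarrow> x \<sqsubseteq>\<^bsub>H\<^esub> v \<and> x \<sqsubseteq>\<^bsub>H\<^esub> w" if "x \<in> carrier H" for x
      using that v(1) w(1)
      by (meson M.H.le_trans M.H.meet_closed M.H.meet_le M.H.meet_left M.H.meet_right)
    then show "\<exists>w\<in>carrier H. \<forall>x\<in>carrier H. x \<cdot>\<^bsub>square pr M\<^esub> p \<sqsubseteq>\<^bsub>square pr M\<^esub> q \<longleftrightarrow> x \<sqsubseteq>\<^bsub>H\<^esub> w"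
      using p q v w by (intro bexI[of _ "v \<sqinter>\<^bsub>H\<^esub> w"]) simp_all
  qed (auto elim!: in_squareE simp: square_join[OF jM] square_bottom[OF jM]
      M.act_closed M.top_act M.bottom_act M.meet_act M.join_act M.act_join
      intro: M.act_mono_left M.act_mono_right)
qed

section \<open>Morphisms out of the square\<close>

lemmas square_module_simps =
  square_join[OF heyting_module_join_semilattice]
  square_bottom[OF heyting_module_join_semilattice]

text \<open>With quantification over encoded pairs replaced by quantification over coordinates, the
  simplification rules for \<open>pr (a, b)\<close> settle membership of the structure maps.\<close>

lemma Hom_square_iff:
  assumes "heyting_module H M" and "heyting_module H N"
  shows "f \<in> Hom (Heymod H) (square pr M) N \<longleftrightarrow>
    f \<in> extensional (carrier (square pr M)) \<and>
    (\<forall>a\<in>carrier M. \<forall>b\<in>carrier M. f (pr (a, b)) \<in> carrier N) \<and>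
    f (pr (\<bottom>\<^bsub>M\<^esub>, \<bottom>\<^bsub>M\<^esub>)) = \<bottom>\<^bsub>N\<^esub> \<and>
    (\<forall>a\<in>carrier M. \<forall>b\<in>carrier M. \<forall>c\<in>carrier M. \<forall>d\<in>carrier M.
      f (pr (a \<squnion>\<^bsub>M\<^esub> c, b \<squnion>\<^bsub>M\<^esub> d)) = f (pr (a, b)) \<squnion>\<^bsub>N\<^esub> f (pr (c, d))) \<and>
    (\<forall>x\<in>carrier H. \<forall>a\<in>carrier M. \<forall>b\<in>carrier M.
      f (pr (x \<cdot>\<^bsub>M\<^esub> a, x \<cdot>\<^bsub>M\<^esub> b)) = x \<cdot>\<^bsub>N\<^esub> f (pr (a, b)))"
  by (auto simp: Hom_Heymod_iff heyting_module_square assms ball_square PiE_def Pi_iff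
      square_module_simps[OF assms(1)])

text \<open>This turns the functor, comonad and Kleisli equations below into evaluations at a
  pair.\<close>

lemma Hom_square_eqI:
  assumes "f \<in> Hom (Heymod H) (square pr M) N" "g \<in> Hom (Heymod H) (square pr M) N"
    and "\<And>a b. \<lbrakk>a \<in> carrier M; b \<in> carrier M\<rbrakk> \<Longrightarrow> f (pr (a, b)) = g (pr (a, b))"
  shows "f = g"
  using assms by (auto intro!: Hom_Heymod_eqI[OF assms(1,2)] elim!: in_squareE)

lemma square_map_pr [simp]:
  "\<lbrakk>a \<in> carrier M; b \<in> carrier M\<rbrakk> \<Longrightarrow> square_map pr M N f (pr (a, b)) = pr (f a, f b)"
  by (simp add: square_map_def)

lemma square_counit_pr [simp]:
  "\<lbrakk>a \<in> carrier M; b \<in> carrier M\<rbrakk> \<Longrightarrow> square_counit pr M (pr (a, b)) = a"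
  by (simp add: square_counit_def)

lemma square_comult_pr [simp]:
  "\<lbrakk>a \<in> carrier M; b \<in> carrier M\<rbrakk>
    \<Longrightarrow> square_comult pr M (pr (a, b)) = pr (pr (a, b), pr (b, a))"
  by (simp add: square_comult_def)

lemma copair_pr [simp]:
  "\<lbrakk>a \<in> carrier M; b \<in> carrier M\<rbrakk> \<Longrightarrow> copair pr M N (f, g) (pr (a, b)) = f a \<squnion>\<^bsub>N\<^esub> g b"
  by (simp add: copair_def)

lemma square_map_in_Hom:
  assumes "heyting_module H M" "heyting_module H N" "f \<in> Hom (Heymod H) M N"
  shows "square_map pr M N f \<in> Hom (Heymod H) (square pr M) (square pr N)"
proof -
  interpret M: heyting_module H M by fact
  have ext: "square_map pr M N f \<in> extensional (carrier (square pr M))"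
    by (simp add: square_map_def)
  show ?thesis
    unfolding Hom_square_iff[OF assms(1) heyting_module_square[OF assms(2)]]
    using assms(3) ext Hom_Heymod_closed[OF assms(3)]
    by (simp add: Hom_Heymod_iff assms(1,2) M.act_closed square_module_simps[OF assms(2)])
qed

lemma square_counit_in_Hom:
  assumes "heyting_module H M"
  shows "square_counit pr M \<in> Hom (Heymod H) (square pr M) M"
proof -
  interpret M: heyting_module H M by fact
  have "square_counit pr M \<in> extensional (carrier (square pr M))"
    by (simp add: square_counit_def)
  then show ?thesis
    by (simp add: Hom_square_iff assms M.act_closed)
qed

lemma square_comult_in_Hom:
  assumes "heyting_module H M"
  shows "square_comult pr M \<in> Hom (Heymod H) (square pr M) (square pr (square pr M))"
proof -
  interpret M: heyting_module H M by fact
  note S = heyting_module_square[OF assms]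
  have "square_comult pr M \<in> extensional (carrier (square pr M))"
    by (simp add: square_comult_def)
  then show ?thesis
    by (simp add: Hom_square_iff assms S heyting_module_square[OF S] M.act_closed
        square_module_simps[OF assms] square_module_simps[OF S])
qed

text \<open>Joins are preserved because the join of \<open>f a \<squnion> g b\<close> and
  \<open>f c \<squnion> g d\<close> regroups into the join of \<open>f a \<squnion> f c\<close> and
  \<open>g b \<squnion> g d\<close>.\<close>

lemma copair_in_Hom:
  assumes "heyting_module H M" "heyting_module H N"
    and "f \<in> Hom (Heymod H) M N" "g \<in> Hom (Heymod H) M N"
  shows "copair pr M N (f, g) \<in> Hom (Heymod H) (square pr M) N"
proof -
  interpret M: heyting_module H M by fact
  interpret N: heyting_module H N by fact
  have "f m \<in> carrier N" "g m \<in> carrier N" if "m \<in> carrier M" for m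
    using that Hom_Heymod_closed[OF assms(3)] Hom_Heymod_closed[OF assms(4)] by simp_all
  moreover have "copair pr M N (f, g) \<in> extensional (carrier (square pr M))"
    by (simp add: copair_def)
  ultimately show ?thesis
    using assms(3,4) unfolding Hom_square_iff[OF assms(1,2)]
    by (simp add: Hom_Heymod_iff assms(1,2) M.act_closed N.act_join
        N.M.join_assoc N.M.join_left_comm join_comm)
qed

section \<open>The squaring functor and the comonad laws\<close>

lemma cat_functor_square: "cat_functor (Heymod H) (Heymod H) (square pr) (square_map pr)"
proof -
  interpret category "Heymod H" by (rule category_Heymod)
  show ?thesis
  proof
    fix M :: "('a, 'u) lmodule" assume M: "M \<in> Obj (Heymod H)"
    then show "square pr M \<in> Obj (Heymod H)"
      by (simp add: heyting_module_square)
    show "square_map pr M M (Idn (Heymod H) M) = Idn (Heymod H) (square pr M)"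
      using M
      by (intro Hom_square_eqI[of _ H M "square pr M"])
        (simp_all add: square_map_in_Hom identity_in_Hom_Heymod heyting_module_square)
  next
    fix M N :: "('a, 'u) lmodule" and f
    assume MN: "M \<in> Obj (Heymod H)" "N \<in> Obj (Heymod H)" and f: "f \<in> Hom (Heymod H) M N"
    then show "square_map pr M N f \<in> Hom (Heymod H) (square pr M) (square pr N)"
      by (simp add: square_map_in_Hom)
    fix P :: "('a, 'u) lmodule" and g
    assume P: "P \<in> Obj (Heymod H)" and g: "g \<in> Hom (Heymod H) N P"
    note hm = MN[unfolded Obj_Heymod] P[unfolded Obj_Heymod]
    note S = hm[THEN heyting_module_square]
    show "square_map pr M P (Cmp (Heymod H) M N P g f) =
        Cmp (Heymod H) (square pr M) (square pr N) (square pr P)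
          (square_map pr N P g) (square_map pr M N f)"
      by (rule Hom_square_eqI[of _ H M "square pr P"])
        (simp_all add: f g hm square_map_in_Hom compose_in_Hom_Heymod[OF hm]
          compose_in_Hom_Heymod[OF S] compose_eq Hom_Heymod_closed[OF f])
  qed
qed

lemma comonad_square:
  "comonad (Heymod H) (square pr) (square_map pr) (square_counit pr) (square_comult pr)"
proof -
  interpret category "Heymod H" by (rule category_Heymod)
  interpret T: cat_functor "Heymod H" "Heymod H" "square pr" "square_map pr"
    by (rule cat_functor_square)
  interpret Id: cat_functor "Heymod H" "Heymod H" "\<lambda>M. M" "\<lambda>M N f. f"
    by (rule cat_functor_id)
  interpret TT: cat_functor "Heymod H" "Heymod H" "\<lambda>M. square pr (square pr M)"
    "\<lambda>M N f. square_map pr (square pr M) (square pr N) (square_map pr M N f)"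
    by (rule cat_functor_comp[OF cat_functor_square cat_functor_square])
  note in_Hom = heyting_module_square square_map_in_Hom square_counit_in_Hom square_comult_in_Hom
    identity_in_Hom_Heymod
  show ?thesis
  proof
    fix M :: "('a, 'u) lmodule" assume "M \<in> Obj (Heymod H)"
    then have M: "heyting_module H M" by simp
    note S = heyting_module_square[OF M]
    note SS = heyting_module_square[OF S]
    note SSS = heyting_module_square[OF SS]
    show "square_counit pr M \<in> Hom (Heymod H) (square pr M) M"
      "square_comult pr M \<in> Hom (Heymod H) (square pr M) (square pr (square pr M))"
      using M by (rule in_Hom)+
    show "Cmp (Heymod H) (square pr M) (square pr (square pr M)) (square pr M)
        (square_counit pr (square pr M)) (square_comult pr M) = Idn (Heymod H) (square pr M)"
      by (rule Hom_square_eqI[of _ H M "square pr M"])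
        (simp_all add: compose_eq compose_in_Hom_Heymod[OF S SS S] in_Hom M)
    \<comment> \<open>The lifted counit takes the first coordinates of \<open>(a, b)\<close> and
      \<open>(b, a)\<close>. The swap in the second copy makes the result \<open>(a, b)\<close>
      again.\<close>
    show "Cmp (Heymod H) (square pr M) (square pr (square pr M)) (square pr M)
        (square_map pr (square pr M) M (square_counit pr M)) (square_comult pr M)
        = Idn (Heymod H) (square pr M)"
      by (rule Hom_square_eqI[of _ H M "square pr M"])
        (simp_all add: compose_eq compose_in_Hom_Heymod[OF S SS S] in_Hom M)
    \<comment> \<open>With \<open>p = (a, b)\<close> and \<open>q = (b, a)\<close>, both sides send
      \<open>(a, b)\<close> to \<open>((p, q), (q, p))\<close>, since swapping \<open>p\<close>
      gives \<open>q\<close> and conversely.\<close>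
    show "Cmp (Heymod H) (square pr M) (square pr (square pr M))
        (square pr (square pr (square pr M))) (square_comult pr (square pr M)) (square_comult pr M)
      = Cmp (Heymod H) (square pr M) (square pr (square pr M))
        (square pr (square pr (square pr M)))
        (square_map pr (square pr M) (square pr (square pr M)) (square_comult pr M))
        (square_comult pr M)"
      by (rule Hom_square_eqI[of _ H M "square pr (square pr (square pr M))"])
        (simp_all add: compose_eq compose_in_Hom_Heymod[OF S SS SSS] in_Hom M)
  next
    fix M N :: "('a, 'u) lmodule" and f
    assume "M \<in> Obj (Heymod H)" "N \<in> Obj (Heymod H)" and f: "f \<in> Hom (Heymod H) M N"
    then have M: "heyting_module H M" and N: "heyting_module H N" by simp_all
    note S = heyting_module_square[OF M] heyting_module_square[OF N]
    note SS = heyting_module_square[OF S(1)] heyting_module_square[OF S(2)]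
    show "Cmp (Heymod H) (square pr M) M N f (square_counit pr M)
      = Cmp (Heymod H) (square pr M) (square pr N) N (square_counit pr N) (square_map pr M N f)"
      by (rule Hom_square_eqI[of _ H M N])
        (simp_all add: compose_eq compose_in_Hom_Heymod[OF S(1) M N]
          compose_in_Hom_Heymod[OF S N] in_Hom M N f Hom_Heymod_closed[OF f])
    show "Cmp (Heymod H) (square pr M) (square pr (square pr M)) (square pr (square pr N))
        (square_map pr (square pr M) (square pr N) (square_map pr M N f)) (square_comult pr M)
      = Cmp (Heymod H) (square pr M) (square pr N) (square pr (square pr N))
        (square_comult pr N) (square_map pr M N f)"
      by (rule Hom_square_eqI[of _ H M "square pr (square pr N)"])
        (simp_all add: compose_eq compose_in_Hom_Heymod[OF S(1) SS]
          compose_in_Hom_Heymod[OF S SS(2)] in_Hom M N f Hom_Heymod_closed[OF f])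
  qed
qed

section \<open>Pairs of morphisms and morphisms out of the square\<close>

text \<open>The inverse sends \<open>h\<close> to its restrictions along \<open>m \<mapsto> (m, 0)\<close> and \<open>n \<mapsto> (0, n)\<close>.\<close>

lemma bij_betw_copair:
  assumes M: "heyting_module H M" and N: "heyting_module H N"
  shows "bij_betw (copair pr M N) (Hom (Heymod H) M N \<times> Hom (Heymod H) M N)
    (Hom (Heymod H) (square pr M) N)"
proof -
  interpret M: heyting_module H M by fact
  interpret N: heyting_module H N by fact
  define inv where "inv h = (\<lambda>m\<in>carrier M. h (pr (m, \<bottom>\<^bsub>M\<^esub>)), \<lambda>n\<in>carrier M. h (pr (\<bottom>\<^bsub>M\<^esub>, n)))"
    for h :: "'u \<Rightarrow> 'u"
  have inv_Hom: "inv h \<in> Hom (Heymod H) M N \<times> Hom (Heymod H) M N"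
    if h: "h \<in> Hom (Heymod H) (square pr M) N" for h
  proof -
    \<comment> \<open>Additivity of \<open>h\<close> on pairs is specialised to pairs with one
      coordinate zero. The zero coordinates join to zero, so the result stays on the same
      factor.\<close>
    have "h (pr (m \<squnion>\<^bsub>M\<^esub> n, \<bottom>\<^bsub>M\<^esub>)) = h (pr (m, \<bottom>\<^bsub>M\<^esub>)) \<squnion>\<^bsub>N\<^esub> h (pr (n, \<bottom>\<^bsub>M\<^esub>))"
      "h (pr (\<bottom>\<^bsub>M\<^esub>, m \<squnion>\<^bsub>M\<^esub> n)) = h (pr (\<bottom>\<^bsub>M\<^esub>, m)) \<squnion>\<^bsub>N\<^esub> h (pr (\<bottom>\<^bsub>M\<^esub>, n))"
      if "m \<in> carrier M" "n \<in> carrier M" for m n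
      using h that unfolding Hom_square_iff[OF M N]
      by (metis M.M.bottom_closed M.M.bottom_join)+
    \<comment> \<open>Here \<open>act_bottom\<close> keeps the zero coordinate at zero under the
      action.\<close>
    moreover have "h (pr (x \<cdot>\<^bsub>M\<^esub> m, \<bottom>\<^bsub>M\<^esub>)) = x \<cdot>\<^bsub>N\<^esub> h (pr (m, \<bottom>\<^bsub>M\<^esub>))"
      "h (pr (\<bottom>\<^bsub>M\<^esub>, x \<cdot>\<^bsub>M\<^esub> m)) = x \<cdot>\<^bsub>N\<^esub> h (pr (\<bottom>\<^bsub>M\<^esub>, m))"
      if "x \<in> carrier H" "m \<in> carrier M" for x m
      using h that unfolding Hom_square_iff[OF M N]
      by (metis M.M.bottom_closed M.act_bottom)+
    ultimately show ?thesis
      using h unfolding Hom_square_iff[OF M N]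
      by (simp add: inv_def Hom_Heymod_iff M N M.act_closed)
  qed
  show ?thesis
  proof (rule bij_betw_byWitness[where f' = inv])
    show "\<forall>fg\<in>Hom (Heymod H) M N \<times> Hom (Heymod H) M N. inv (copair pr M N fg) = fg"
    proof (clarify)
      fix f g assume fg: "f \<in> Hom (Heymod H) M N" "g \<in> Hom (Heymod H) M N"
      \<comment> \<open>Restricting \<open>copair\<close> to one factor leaves the other morphism
        evaluated at zero, and that term vanishes from the join.\<close>
      have [simp]: "f \<bottom>\<^bsub>M\<^esub> = \<bottom>\<^bsub>N\<^esub>" "g \<bottom>\<^bsub>M\<^esub> = \<bottom>\<^bsub>N\<^esub>"
        using fg by (simp_all add: Hom_Heymod_iff M N)
      show "inv (copair pr M N (f, g)) = (f, g)"
        using fg Hom_Heymod_closed[OF fg(1)] Hom_Heymod_closed[OF fg(2)]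
        by (auto simp: inv_def intro!: extensionalityI[of _ "carrier M"]
            Hom_Heymod_extensional[OF fg(1)] Hom_Heymod_extensional[OF fg(2)])
    qed
    show "\<forall>h\<in>Hom (Heymod H) (square pr M) N. copair pr M N (inv h) = h"
    proof
      fix h assume h: "h \<in> Hom (Heymod H) (square pr M) N"
      \<comment> \<open>The coproduct decomposition: \<open>(a, b)\<close> is the join of
        \<open>(a, 0)\<close> and \<open>(0, b)\<close>, and \<open>h\<close> preserves this
        join.\<close>
      have dec: "h (pr (a, \<bottom>\<^bsub>M\<^esub>)) \<squnion>\<^bsub>N\<^esub> h (pr (\<bottom>\<^bsub>M\<^esub>, b)) = h (pr (a, b))"
        if "a \<in> carrier M" "b \<in> carrier M" for a b
        using h that unfolding Hom_square_iff[OF M N]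
        by (metis M.M.bottom_closed M.M.bottom_join M.M.join_bottom)
      have "copair pr M N (inv h) \<in> Hom (Heymod H) (square pr M) N"
        using inv_Hom[OF h] copair_in_Hom[OF M N] by (auto simp: inv_def)
      then show "copair pr M N (inv h) = h"
        using h by (rule Hom_square_eqI) (simp add: inv_def dec)
    qed
    show "copair pr M N ` (Hom (Heymod H) M N \<times> Hom (Heymod H) M N)
        \<subseteq> Hom (Heymod H) (square pr M) N"
      using copair_in_Hom[OF M N] by auto
    show "inv ` Hom (Heymod H) (square pr M) N \<subseteq> Hom (Heymod H) M N \<times> Hom (Heymod H) M N"
      using inv_Hom by blast
  qed
qed

text \<open>The Kleisli identity is the counit, and \<open>m \<squnion> 0 = m\<close> is its value
  at \<open>(m, n)\<close>. Hence the second component of an identity of \<open>Heymod2\<close> is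
  the zero morphism.\<close>

lemma copair_identity:
  assumes "heyting_module H M"
  shows "copair pr M M (Idn (Heymod H) M, hom_zero M M) = square_counit pr M"
proof -
  interpret M: heyting_module H M by fact
  show ?thesis
    by (rule Hom_square_eqI[of _ H M M])
      (simp_all add: assms copair_in_Hom identity_in_Hom_Heymod
        hom_zero_in_Hom[unfolded hom_zero_def] square_counit_in_Hom hom_zero_def)
qed

text \<open>The swap in the comultiplication makes \<open>g'\<close> receive the value of
  \<open>copair\<close> at \<open>(b, a)\<close>. This is the source of the crossed terms in the
  composition of \<open>Heymod2\<close>.\<close>

lemma copair_Cmp_Heymod2:
  assumes M: "heyting_module H M" and N: "heyting_module H N" and P: "heyting_module H P"
    and f: "f \<in> Hom (Heymod H) M N" and g: "g \<in> Hom (Heymod H) M N"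
    and f': "f' \<in> Hom (Heymod H) N P" and g': "g' \<in> Hom (Heymod H) N P"
  shows "copair pr M P (Cmp (Heymod2 H) M N P (f', g') (f, g)) =
    compose (carrier (square pr M)) (copair pr N P (f', g'))
      (compose (carrier (square pr M)) (square_map pr (square pr M) N (copair pr M N (f, g)))
        (square_comult pr M))"
proof -
  interpret N: heyting_module H N by fact
  interpret P: heyting_module H P by fact
  note S = heyting_module_square[OF M] heyting_module_square[OF N]
  note SS = heyting_module_square[OF S(1)]
  note fg = copair_in_Hom[OF M N f g]
  have in_N: "f m \<in> carrier N" "g m \<in> carrier N" if "m \<in> carrier M" for m
    using that f g by (simp_all add: Hom_Heymod_closed)
  have in_P: "f' n \<in> carrier P" "g' n \<in> carrier P" if "n \<in> carrier N" for n
    using that f' g' by (simp_all add: Hom_Heymod_closed)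
  have join: "f' (a \<squnion>\<^bsub>N\<^esub> b) = f' a \<squnion>\<^bsub>P\<^esub> f' b" "g' (a \<squnion>\<^bsub>N\<^esub> b) = g' a \<squnion>\<^bsub>P\<^esub> g' b"
    if "a \<in> carrier N" "b \<in> carrier N" for a b
    using that f' g' by (simp_all add: Hom_Heymod_iff N P)
  show ?thesis
  proof (rule Hom_square_eqI[of _ H M P])
    show "copair pr M P (Cmp (Heymod2 H) M N P (f', g') (f, g)) \<in> Hom (Heymod H) (square pr M) P"
      using f g f' g'
      by (simp add: Heymod2_def copair_in_Hom hom_plus_in_Hom compose_in_Hom_Heymod[OF M N P] M P)
    show "compose (carrier (square pr M)) (copair pr N P (f', g'))
      (compose (carrier (square pr M)) (square_map pr (square pr M) N (copair pr M N (f, g)))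
        (square_comult pr M)) \<in> Hom (Heymod H) (square pr M) P"
      by (rule compose_in_Hom_Heymod[OF S P compose_in_Hom_Heymod[OF S(1) SS S(2)]])
        (simp_all add: square_comult_in_Hom square_map_in_Hom copair_in_Hom M N P S f g f' g')
    show "copair pr M P (Cmp (Heymod2 H) M N P (f', g') (f, g)) (pr (a, b)) =
      compose (carrier (square pr M)) (copair pr N P (f', g'))
        (compose (carrier (square pr M)) (square_map pr (square pr M) N (copair pr M N (f, g)))
          (square_comult pr M)) (pr (a, b))"
      if "a \<in> carrier M" "b \<in> carrier M" for a b
      \<comment> \<open>As \<open>f'\<close> and \<open>g'\<close> preserve binary joins, both sides
        are joins of the same four elements \<open>f' (f a)\<close>, \<open>g' (g a)\<close>,
        \<open>f' (g b)\<close> and \<open>g' (f b)\<close>. Associativity and commutativity in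
        \<open>P\<close> match them.\<close>
      using that
      by (simp add: Heymod2_def hom_plus_def compose_eq in_N in_P join
          P.M.join_assoc P.M.join_left_comm join_comm)
  qed
qed

end

theorem proposition7p3:
  fixes H :: "'h gorder" and pr :: "'u \<times> 'u \<Rightarrow> 'u"
  assumes "heyting_algebra H" and "finite (carrier H)"
    and "inj pr"
  shows "comonad (Heymod H) (square pr) (square_map pr) (square_counit pr) (square_comult pr) \<and>
    cat_isomorphism
      (Heymod2 H)
      (Kleisli (Heymod H) (square pr) (square_map pr) (square_counit pr) (square_comult pr))
      (\<lambda>M. M) (copair pr)"
proof -
  interpret pairing pr by unfold_locales fact
  interpret comonad "Heymod H" "square pr" "square_map pr" "square_counit pr" "square_comult pr"
    by (rule comonad_square)
  have "cat_isomorphism (Heymod2 H)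
    (Kleisli (Heymod H) (square pr) (square_map pr) (square_counit pr) (square_comult pr))
    (\<lambda>M. M) (copair pr)"
  \<comment> \<open>The category laws are known for the Kleisli category and are carried back along
    \<open>copair\<close>. For \<open>Heymod2\<close> it remains to check closure of its hom-sets
    and compatibility of \<open>copair\<close> with identities and composition.\<close>
  proof (rule cat_isomorphismI[OF category_Kleisli])
    fix M N P :: "('h, 'u) lmodule" and f g
    assume "M \<in> Obj (Heymod2 H)" "N \<in> Obj (Heymod2 H)" "P \<in> Obj (Heymod2 H)"
      "f \<in> Hom (Heymod2 H) M N" "g \<in> Hom (Heymod2 H) N P"
    then show "Cmp (Heymod2 H) M N P g f \<in> Hom (Heymod2 H) M P"
      "copair pr M P (Cmp (Heymod2 H) M N P g f) =
        Cmp (Kleisli (Heymod H) (square pr) (square_map pr) (square_counit pr) (square_comult pr))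
          M N P (copair pr N P g) (copair pr M N f)"
      using copair_Cmp_Heymod2[of H M N P "fst f" "snd f" "fst g" "snd g"]
      by (auto simp: Heymod2_def Kleisli_def
          intro!: hom_plus_in_Hom compose_in_Hom_Heymod[where N = N])
  \<comment> \<open>The two categories share their objects, so the object map is the identity. On
    hom-sets the bijection is \<open>bij_betw_copair\<close>.\<close>
  qed (auto simp: Heymod2_def Kleisli_def bij_betw_copair copair_identity[of H, simplified]
      identity_in_Hom_Heymod hom_zero_in_Hom bij_betw_id[unfolded id_def])
  with comonad_axioms show ?thesis ..
qed

end
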